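(* Let $S=\{s_n\}_{n\ge1}$ and $T=\{t_n\}_{n\ge1}$ be increasing sequences (finite or infinite) of positive odd integers, and let $W=\{w_n\}_{n\ge1}=S\cap T$ be the increasing sequence of their common terms. For real $y$ let $S(y)=\#\{n: s_n\le y\}$, $T(y)=\#\{n: t_n\le y\}$, $W(y)=\#\{n: w_n\le y\}$ be the counting functions. For a positive even integer $x$, let $g(x)$ be the number of solutions of $x=s+t$ with $s\in S$, $t\in T$, where the order of the summands is not important; that is, $g(x)$ is the number of pairs $(a,b)$ of integers with $a\le b$, $a+b=x$, such that ($a\in S$ and $b\in T$) or ($a\in T$ and $b\in S$). Then for every even $x\ge4$, $$g(x)=\sum_{t\in T,\ t\le x/2}S(x-t)+\sum_{s\in S,\ s\le x/2}T(x-s)-\sum_{w\in W,\ w\le x/2}W(x-w)-S(x/2)\,T(x/2)+\binom{W(x/2)+1}{2}-g(x-2)-g(x-4)-\dots-g(2).$$ *)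

theory Defs
  imports Complex_Main "HOL-Library.Extended_Nat"
begin

text \<open>
  A finite or infinite sequence \<open>s\<^sub>1, s\<^sub>2, \<dots>\<close> is given by a function \<open>s\<close> together with
  its length \<open>N :: enat\<close>; values of \<open>s\<close> outside the index set are irrelevant.
\<close>

definition indices :: "enat \<Rightarrow> nat set" where
  "indices N = {n. 1 \<le> n \<and> enat n \<le> N}"

definition seq_terms :: "enat \<Rightarrow> (nat \<Rightarrow> int) \<Rightarrow> int set" where
  "seq_terms N s = s ` indices N"

definition increasing_seq :: "enat \<Rightarrow> (nat \<Rightarrow> int) \<Rightarrow> bool" where
  "increasing_seq N s \<longleftrightarrow> strict_mono_on (indices N) s"

definition increasing_odd_seq :: "enat \<Rightarrow> (nat \<Rightarrow> int) \<Rightarrow> bool" where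
  "increasing_odd_seq N s \<longleftrightarrow>
     increasing_seq N s \<and> (\<forall>n\<in>indices N. 0 < s n \<and> odd (s n))"

definition counting :: "enat \<Rightarrow> (nat \<Rightarrow> int) \<Rightarrow> real \<Rightarrow> nat" where
  "counting N s y = card {n \<in> indices N. real_of_int (s n) \<le> y}"

definition num_reps :: "int set \<Rightarrow> int set \<Rightarrow> int \<Rightarrow> nat" where
  "num_reps A B x =
     card {(a, b). a \<le> b \<and> a + b = x \<and> (a \<in> A \<and> b \<in> B \<or> a \<in> B \<and> b \<in> A)}"

end

theory Submission
  imports Defs
begin

text \<open>
  Both sides, with the subtracted values of \<open>g\<close> moved to the left, count the unordered pairs
  with one entry in \<open>S\<close>, the other in \<open>T\<close> and sum at most \<open>x\<close>.  In an ordered pair with sum at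
  most \<open>x\<close> at least one entry is at most \<open>x / 2\<close>, so the number of ordered pairs in \<open>S \<times> T\<close>
  is the sum of the first two sums minus \<open>S(x/2) T(x/2)\<close>.  Writing the unordered pairs as \<open>a \<le> b\<close>,
  inclusion-exclusion over \<open>(a, b) \<in> S \<times> T\<close> and \<open>(a, b) \<in> T \<times> S\<close> reduces them to ordered pairs,
  up to the diagonal; the overlap consists of unordered pairs from \<open>W\<close>, to which the same two
  counts apply with \<open>S = T = W\<close>.
\<close>

definition bounded_pairs :: "int set \<Rightarrow> int set \<Rightarrow> int \<Rightarrow> (int \<times> int) set" where
  "bounded_pairs A B x = {(a, b). a \<in> A \<and> b \<in> B \<and> a + b \<le> x}"

text \<open>An unordered pair is represented by its sorted version. The smaller entry is tied to the
  first set, so the unordered pairs are the union of \<open>sorted_pairs A B x\<close> and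
  \<open>sorted_pairs B A x\<close>.\<close>

definition sorted_pairs :: "int set \<Rightarrow> int set \<Rightarrow> int \<Rightarrow> (int \<times> int) set" where
  "sorted_pairs A B x = {(a, b) \<in> bounded_pairs A B x. a \<le> b}"

lemma finite_positive_bounded:
  fixes A :: "int set"
  assumes "A \<subseteq> {0<..}"
  shows "finite {a \<in> A. a \<le> y}"
  by (rule finite_subset[of _ "{0..y}"]) (use assms in auto)

lemma finite_bounded_pairs:
  assumes "A \<subseteq> {0<..}" "B \<subseteq> {0<..}"
  shows "finite (bounded_pairs A B x)"
proof (rule finite_subset)
  show "bounded_pairs A B x \<subseteq> {0..x} \<times> {0..x}"
    using assms by (force simp: bounded_pairs_def)
qed simp

lemma finite_sorted_pairs:
  assumes "A \<subseteq> {0<..}" "B \<subseteq> {0<..}"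
  shows "finite (sorted_pairs A B x)"
  by (rule finite_subset[OF _ finite_bounded_pairs[OF assms]]) (auto simp: sorted_pairs_def)

lemma sum_card_complement:
  assumes "A \<subseteq> {0<..}" "B \<subseteq> {0<..}"
  shows "(\<Sum>a \<in> {a \<in> A. a \<le> h}. card {b \<in> B. b \<le> x - a}) =
    card {(a, b) \<in> bounded_pairs A B x. a \<le> h}"
proof -
  have "{(a, b) \<in> bounded_pairs A B x. a \<le> h} =
      (SIGMA a : {a \<in> A. a \<le> h}. {b \<in> B. b \<le> x - a})"
    by (auto simp: bounded_pairs_def)
  then show ?thesis
    using assms by (simp add: finite_positive_bounded)
qed

lemma card_bounded_pairs:
  assumes A: "A \<subseteq> {0<..}" and B: "B \<subseteq> {0<..}"
  shows "card (bounded_pairs A B (2 * h)) + card {a \<in> A. a \<le> h} * card {b \<in> B. b \<le> h} =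
    (\<Sum>a \<in> {a \<in> A. a \<le> h}. card {b \<in> B. b \<le> 2 * h - a}) +
    (\<Sum>b \<in> {b \<in> B. b \<le> h}. card {a \<in> A. a \<le> 2 * h - b})"
proof -
  define L where "L = {(a, b) \<in> bounded_pairs A B (2 * h). a \<le> h}"
  define R where "R = {(a, b) \<in> bounded_pairs A B (2 * h). b \<le> h}"
  have fin: "finite L" "finite R"
    unfolding L_def R_def
    by (rule finite_subset[OF _ finite_bounded_pairs[OF A B, of "2 * h"]], auto)+
  \<comment> \<open>Swapping the entries lets \<open>sum_card_complement\<close> count
    \<open>R\<close> as well, with \<open>A\<close> and \<open>B\<close> exchanged.\<close>
  have "R = prod.swap ` {(b, a) \<in> bounded_pairs B A (2 * h). b \<le> h}"
    by (force simp: R_def bounded_pairs_def)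
  then have "card R = card {(b, a) \<in> bounded_pairs B A (2 * h). b \<le> h}"
    by (simp add: card_image)
  moreover have "L \<union> R = bounded_pairs A B (2 * h)"
    by (auto simp: L_def R_def bounded_pairs_def)
  \<comment> \<open>Two entries at most \<open>h\<close> have sum at most \<open>2 * h\<close>, so
    the overlap is a full rectangle.\<close>
  moreover have "L \<inter> R = {a \<in> A. a \<le> h} \<times> {b \<in> B. b \<le> h}"
    by (auto simp: L_def R_def bounded_pairs_def)
  ultimately show ?thesis
    using card_Un_Int[OF fin]
    by (simp add: sum_card_complement A B card_cartesian_product flip: L_def)
qed

text \<open>Each ordered pair is sorted or becomes so after a swap. Both happen exactly on the
  diagonal, where \<open>c + c \<le> 2 * h\<close> means \<open>c \<le> h\<close>.\<close>

lemma card_sorted_pairs: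
  assumes A: "A \<subseteq> {0<..}" and B: "B \<subseteq> {0<..}"
  shows "card (sorted_pairs A B (2 * h)) + card (sorted_pairs B A (2 * h)) =
    card (bounded_pairs A B (2 * h)) + card {c \<in> A \<inter> B. c \<le> h}"
proof -
  define L where "L = sorted_pairs A B (2 * h)"
  define R where "R = prod.swap ` sorted_pairs B A (2 * h)"
  have fin: "finite L" "finite R"
    by (simp_all add: L_def R_def finite_sorted_pairs A B)
  have "L \<union> R = bounded_pairs A B (2 * h)"
    by (force simp: L_def R_def sorted_pairs_def bounded_pairs_def)
  moreover have "L \<inter> R = (\<lambda>c. (c, c)) ` {c \<in> A \<inter> B. c \<le> h}"
    by (force simp: L_def R_def sorted_pairs_def bounded_pairs_def)
  then have "card (L \<inter> R) = card {c \<in> A \<inter> B. c \<le> h}"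
    by (simp add: card_image inj_on_def)
  ultimately show ?thesis
    using card_Un_Int[OF fin] by (simp add: L_def R_def card_image)
qed

text \<open>With \<open>B = A\<close> the two preceding counts give twice the wanted cardinality, up
  to \<open>n - n * n\<close>, where \<open>n\<close> is the number of elements up to
  \<open>h\<close>. Half of this is \<open>n\<close> minus the binomial coefficient;
  \<open>n\<close> stays separate because it cancels in the next lemma.\<close>

lemma card_sorted_pairs_same:
  assumes A: "A \<subseteq> {0<..}"
  shows "int (card (sorted_pairs A A (2 * h))) =
    (\<Sum>a \<in> {a \<in> A. a \<le> h}. int (card {b \<in> A. b \<le> 2 * h - a})) +
    int (card {a \<in> A. a \<le> h}) - int ((card {a \<in> A. a \<le> h} + 1) choose 2)"
proof -
  define n where "n = card {a \<in> A. a \<le> h}"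
  \<comment> \<open>The doubled form avoids integer division.\<close>
  have "2 * ((n + 1) choose 2) = (n + 1) * n"
    by (simp add: choose_two)
  then have "2 * int ((n + 1) choose 2) = int n * int n + int n"
    by (metis (no_types, lifting) add.commute distrib_right mult_1 of_nat_1 of_nat_add
        of_nat_mult of_nat_numeral)
  moreover have "2 * int (card (sorted_pairs A A (2 * h))) + int n * int n =
      2 * (\<Sum>a \<in> {a \<in> A. a \<le> h}. int (card {b \<in> A. b \<le> 2 * h - a})) + int n"
    using arg_cong[OF card_sorted_pairs[OF A A, of h], of int]
      arg_cong[OF card_bounded_pairs[OF A A, of h], of int]
    by (simp add: n_def)
  ultimately show ?thesis
    by (simp add: n_def)
qed

text \<open>A pair lies in both sorted sets iff both its entries lie in \<open>A \<inter> B\<close>.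
  The diagonal term of \<open>card_sorted_pairs\<close> cancels against that of
  \<open>card_sorted_pairs_same\<close>, so only the binomial coefficient remains.\<close>

lemma card_sorted_pairs_Un:
  assumes A: "A \<subseteq> {0<..}" and B: "B \<subseteq> {0<..}"
  shows "int (card (sorted_pairs A B (2 * h) \<union> sorted_pairs B A (2 * h))) =
    (\<Sum>b \<in> {b \<in> B. b \<le> h}. int (card {a \<in> A. a \<le> 2 * h - b})) +
    (\<Sum>a \<in> {a \<in> A. a \<le> h}. int (card {b \<in> B. b \<le> 2 * h - a})) -
    (\<Sum>c \<in> {c \<in> A \<inter> B. c \<le> h}. int (card {d \<in> A \<inter> B. d \<le> 2 * h - c})) -
    int (card {a \<in> A. a \<le> h}) * int (card {b \<in> B. b \<le> h}) +
    int ((card {c \<in> A \<inter> B. c \<le> h} + 1) choose 2)"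
proof -
  have "sorted_pairs A B (2 * h) \<inter> sorted_pairs B A (2 * h) =
      sorted_pairs (A \<inter> B) (A \<inter> B) (2 * h)"
    by (auto simp: sorted_pairs_def bounded_pairs_def)
  then have "int (card (sorted_pairs A B (2 * h))) + int (card (sorted_pairs B A (2 * h))) =
      int (card (sorted_pairs A B (2 * h) \<union> sorted_pairs B A (2 * h))) +
      int (card (sorted_pairs (A \<inter> B) (A \<inter> B) (2 * h)))"
    using card_Un_Int[OF finite_sorted_pairs[OF A B] finite_sorted_pairs[OF B A],
        of "2 * h" "2 * h"]
    by simp
  moreover have "A \<inter> B \<subseteq> {0<..}"
    using A by auto
  note card_sorted_pairs_same[OF this, of h]
  ultimately show ?thesis
    using arg_cong[OF card_sorted_pairs[OF A B, of h], of int]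
      arg_cong[OF card_bounded_pairs[OF A B, of h], of int]
    by simp
qed

text \<open>The pairs are partitioned by their sum, which is even and at least 2 because the entries
  are odd and positive.\<close>

lemma sum_num_reps:
  assumes A: "A \<subseteq> {0<..}" "\<And>a. a \<in> A \<Longrightarrow> odd a"
    and B: "B \<subseteq> {0<..}" "\<And>b. b \<in> B \<Longrightarrow> odd b"
  shows "(\<Sum>k \<in> {k. even k \<and> 2 \<le> k \<and> k \<le> x}. num_reps A B k) =
    card (sorted_pairs A B x \<union> sorted_pairs B A x)"
proof -
  define I :: "int set" where "I = {k. even k \<and> 2 \<le> k \<and> k \<le> x}"
  define P where "P k = {(a, b). a \<le> b \<and> a + b = k \<and> (a \<in> A \<and> b \<in> B \<or> a \<in> B \<and> b \<in> A)}"
    for k :: int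
  define Q where "Q = sorted_pairs A B x \<union> sorted_pairs B A x"
  have I: "finite I"
    by (rule finite_subset[of _ "{2..x}"]) (auto simp: I_def)
  have "a + b \<in> I" if "(a, b) \<in> Q" for a b
    using that A B by (fastforce simp: Q_def I_def sorted_pairs_def bounded_pairs_def)
  then have Q: "Q = (\<Union>k\<in>I. P k)"
    by (auto simp: Q_def P_def I_def sorted_pairs_def bounded_pairs_def)
  have "finite Q"
    by (simp add: Q_def finite_sorted_pairs A B)
  then have "finite (P k)" if "k \<in> I" for k
    using that Q by (auto intro: finite_subset)
  then have "card Q = (\<Sum>k\<in>I. card (P k))"
    unfolding Q using I by (intro card_UN_disjoint) (auto simp: P_def)
  then show ?thesis
    by (simp add: num_reps_def P_def Q_def I_def)
qed

text \<open>An increasing sequence is injective, so counting indices is the same as counting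
  terms.\<close>

lemma counting_eq_card:
  assumes "increasing_seq N s"
  shows "counting N s (real_of_int y) = card {a \<in> seq_terms N s. a \<le> y}"
proof -
  have "inj_on s (indices N)"
    using assms by (auto simp: increasing_seq_def intro: strict_mono_on_imp_inj_on)
  then have "inj_on s {n \<in> indices N. s n \<le> y}"
    by (rule inj_on_subset) auto
  moreover have "{a \<in> seq_terms N s. a \<le> y} = s ` {n \<in> indices N. s n \<le> y}"
    by (auto simp: seq_terms_def)
  ultimately show ?thesis
    by (simp add: counting_def card_image)
qed

theorem theorem1:
  fixes s t w :: "nat \<Rightarrow> int" and K L M :: enat
    and S T W :: "int set" and cS cT cW :: "real \<Rightarrow> nat"
    and g :: "int \<Rightarrow> nat" and x :: int
  assumes s: "increasing_odd_seq K s" and t: "increasing_odd_seq L t"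
    and w: "increasing_seq M w"
    and common: "seq_terms M w = seq_terms K s \<inter> seq_terms L t"
  defines "S \<equiv> seq_terms K s" and "T \<equiv> seq_terms L t" and "W \<equiv> seq_terms M w"
    and "cS \<equiv> counting K s" and "cT \<equiv> counting L t" and "cW \<equiv> counting M w"
    and "g \<equiv> num_reps S T"
  assumes x: "even x" "4 \<le> x"
  shows "int (g x) =
      (\<Sum>b \<in> {b \<in> T. real_of_int b \<le> real_of_int x / 2}. int (cS (real_of_int (x - b))))
    + (\<Sum>a \<in> {a \<in> S. real_of_int a \<le> real_of_int x / 2}. int (cT (real_of_int (x - a))))
    - (\<Sum>c \<in> {c \<in> W. real_of_int c \<le> real_of_int x / 2}. int (cW (real_of_int (x - c))))
    - int (cS (real_of_int x / 2)) * int (cT (real_of_int x / 2))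
    + int ((cW (real_of_int x / 2) + 1) choose 2)
    - (\<Sum>k \<in> {k. even k \<and> 2 \<le> k \<and> k \<le> x - 2}. int (g k))"
proof -
  obtain h where h: "x = 2 * h"
    using x(1) by auto
  then have half: "real_of_int x / 2 = real_of_int h"
    by simp
  have incr: "increasing_seq K s" "increasing_seq L t"
    using s t by (simp_all add: increasing_odd_seq_def)
  have S: "S \<subseteq> {0<..}" "\<And>a. a \<in> S \<Longrightarrow> odd a"
    using s by (auto simp: S_def seq_terms_def increasing_odd_seq_def)
  have T: "T \<subseteq> {0<..}" "\<And>b. b \<in> T \<Longrightarrow> odd b"
    using t by (auto simp: T_def seq_terms_def increasing_odd_seq_def)
  have W: "W = S \<inter> T"
    by (simp add: S_def T_def W_def common)
  \<comment> \<open>As \<open>x\<close> is even, \<open>x - 1\<close> is odd and drops out.\<close>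
  have "{k. even k \<and> 2 \<le> k \<and> k \<le> x} = insert x {k. even k \<and> 2 \<le> k \<and> k \<le> x - 2}"
    using x by (auto elim!: evenE)
  moreover have "finite {k. even k \<and> 2 \<le> k \<and> k \<le> x - 2}"
    by (rule finite_subset[of _ "{2..x}"]) auto
  ultimately have "(\<Sum>k \<in> {k. even k \<and> 2 \<le> k \<and> k \<le> x}. g k) =
      g x + (\<Sum>k \<in> {k. even k \<and> 2 \<le> k \<and> k \<le> x - 2}. g k)"
    by simp
  then have "int (g x) + (\<Sum>k \<in> {k. even k \<and> 2 \<le> k \<and> k \<le> x - 2}. int (g k)) =
      int (card (sorted_pairs S T x \<union> sorted_pairs T S x))"
    using sum_num_reps[OF S T, of x] by (simp add: g_def flip: of_nat_sum)
  moreover have "cS (real_of_int y) = card {a \<in> S. a \<le> y}"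
    "cT (real_of_int y) = card {b \<in> T. b \<le> y}"
    "cW (real_of_int y) = card {c \<in> S \<inter> T. c \<le> y}" for y
    using counting_eq_card[OF incr(1)] counting_eq_card[OF incr(2)] counting_eq_card[OF w]
    by (simp_all add: cS_def cT_def cW_def S_def T_def common)
  \<comment> \<open>The difference \<open>x - b\<close> must stay under a single cast, so that the
    equations for the counting functions at integers apply.\<close>
  ultimately show ?thesis
    using card_sorted_pairs_Un[OF S(1) T(1), of h]
    unfolding half W of_int_le_iff by (simp add: h del: of_int_diff)
qed

end
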